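(* Let $\mathcal{A}=\{a_1,\dots,a_n\}\subset\mathbb{R}^d$. Assume that the matrix $A\in\mathbb{R}^{(d+1)\times n}$ with columns $(1,a_1),\dots,(1,a_n)$ and the matrix $C\in\mathbb{R}^{d\times n}$ are uniform. Suppose there exists a dominating Gale dual matrix $B\in\mathbb{R}^{n\times k}$ of $A$, with columns $B_1,\dots,B_k$. Assume $\mathbf{0}\in\mathcal{C}^\circ$ and $\operatorname{sign}(B_j)\in\operatorname{sign}(\ker(C))$ for each $j=1,\dots,k$. Then $n_{\mathcal{A}}(C)>0$.
   Context: Setting: $d\ge1$, $n\ge d+2$, $k=n-d-1$, and $a_1,\dots,a_n$ are distinct points of $\mathbb{R}^d$. For $C=(c_{ij})\in\mathbb{R}^{d\times n}$, $n_{\mathcal{A}}(C)$ is the (possibly infinite) number of solutions $x\in\mathbb{R}_{>0}^d$ of the system $\sum_{j=1}^n c_{ij}x^{a_j}=0$, $i=1,\dots,d$ (real exponents, $x^{a}=\prod_l x_l^{a_{l}}$). A matrix is uniform if all its maximal minors are nonzero. For $M\in\mathbb{R}^{r\times s}$ of rank $r$, a Gale dual matrix of $M$ is any $N\in\mathbb{R}^{s\times(s-r)}$ whose columns form a basis of $\ker M$. A real matrix is mixed if every column contains a strictly positive and a strictly negative entry; it is dominating if it contains no (nonempty) square mixed submatrix. $\mathcal{C}^\circ=\mathbb{R}_{>0}C_1+\dots+\mathbb{R}_{>0}C_n$, where $C_1,\dots,C_n\in\mathbb{R}^d$ are the columns of $C$. For $v\in\mathbb{R}^n$, $\operatorname{sign}(v)\in\{-1,0,1\}^n$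 is the vector of signs of its coordinates, and for a subspace $S\subset\mathbb{R}^n$, $\operatorname{sign}(S)=\{\operatorname{sign}(v):v\in S\}$. *)

theory Defs
  imports "HOL-Analysis.Analysis" "HOL-Library.Extended_Nat"
begin

(* A minor is selected by an injection of index types; reordering the selected rows or columns
   only changes its sign. For r < s only the first conjunct has instances, for r > s only the
   second one, and for r = s both say that the determinant is nonzero. *)
definition uniform_matrix :: "real^'s^'r \<Rightarrow> bool" where
  "uniform_matrix M \<longleftrightarrow>
     (\<forall>f :: 'r \<Rightarrow> 's. inj f \<longrightarrow> det (\<chi> i j. M $ i $ f j) \<noteq> 0) \<and>
     (\<forall>g :: 's \<Rightarrow> 'r. inj g \<longrightarrow> det (\<chi> i j. M $ g i $ j) \<noteq> 0)"

(* The number of columns of N is not fixed by a premise: being a basis of the kernel of the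
   full-rank matrix M forces CARD('t) = CARD('s) - CARD('r). Injectivity is needed because
   "columns N" is a set and forgets repetitions. *)
definition gale_dual :: "real^'s^'r \<Rightarrow> real^'t^'s \<Rightarrow> bool" where
  "gale_dual M N \<longleftrightarrow>
     rank M = CARD('r) \<and>
     inj (\<lambda>j. column j N) \<and> independent (columns N) \<and> span (columns N) = {v. M *v v = 0}"

(* The submatrix of M with row set I and column set J is mixed. *)
definition mixed_on :: "'r set \<Rightarrow> 's set \<Rightarrow> real^'s^'r \<Rightarrow> bool" where
  "mixed_on I J M \<longleftrightarrow> (\<forall>j\<in>J. (\<exists>i\<in>I. M $ i $ j > 0) \<and> (\<exists>i\<in>I. M $ i $ j < 0))"

definition dominating :: "real^'s^'r \<Rightarrow> bool" where
  "dominating M \<longleftrightarrow> \<not> (\<exists>I J. I \<noteq> {} \<and> J \<noteq> {} \<and> card I = card J \<and> mixed_on I J M)"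

(* Row None is the row of ones, the rows Some l hold the l-th coordinates of the points. *)
definition exponent_matrix :: "('n \<Rightarrow> real^'d) \<Rightarrow> real^'n^('d option)" where
  "exponent_matrix a = (\<chi> i j. case i of None \<Rightarrow> 1 | Some l \<Rightarrow> a j $ l)"

definition monomial :: "real^'d \<Rightarrow> real^'d \<Rightarrow> real" where
  "monomial x b = (\<Prod>l\<in>UNIV. (x $ l) powr (b $ l))"

definition positive_solutions :: "('n \<Rightarrow> real^'d) \<Rightarrow> real^'n^'d \<Rightarrow> (real^'d) set" where
  "positive_solutions a C =
     {x. (\<forall>l. x $ l > 0) \<and> (\<forall>i. (\<Sum>j\<in>UNIV. C $ i $ j * monomial x (a j)) = 0)}"

definition num_positive_solutions :: "('n \<Rightarrow> real^'d) \<Rightarrow> real^'n^'d \<Rightarrow> enat" where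
  "num_positive_solutions a C =
     (if finite (positive_solutions a C) then enat (card (positive_solutions a C)) else \<infinity>)"

definition open_column_cone :: "real^'n^'d \<Rightarrow> (real^'d) set" where
  "open_column_cone C = {\<Sum>j\<in>UNIV. t j *\<^sub>R column j C | t. \<forall>j. t j > 0}"

definition sign_vec :: "real^'n \<Rightarrow> real^'n" where
  "sign_vec v = (\<chi> i. sgn (v $ i))"

end

theory Submission
  imports Defs
begin

text \<open>Choose \<open>u > 0\<close> in \<open>ker C\<close> and a matrix \<open>W\<close> with columns in \<open>ker C\<close> and the signs of \<open>B\<close>. A
  positive solution exists as soon as some positive \<open>v = u + W y\<close> satisfies \<open>B\<^sup>T ln v = 0\<close>, because
  \<open>ln v\<close> is then in the row space of \<open>A\<close>. The positive \<open>v\<close> form a bounded convex neighbourhood of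
  \<open>y = 0\<close>, and by Brouwer's theorem \<open>g y = B\<^sup>T ln (u + W y)\<close> has a zero there unless \<open>g y = - c y\<close> with
  \<open>c \<ge> 0\<close> at points \<open>y\<close> arbitrarily close to the boundary. The latter is impossible: if the coordinates in \<open>I\<close>
  vanish at a boundary point \<open>y\<close>, then \<open>W y\<close> is negative on \<open>I\<close>, and domination yields a column \<open>j\<close> for
  which \<open>y\<^sub>j B\<^sub>i\<^sub>j \<le> 0\<close> on \<open>I\<close>, not always zero, so that \<open>y\<^sub>j g\<^sub>j\<close> tends to \<open>+\<infinity>\<close> there.\<close>

section \<open>Combinatorics of dominating matrices\<close>

text \<open>Otherwise choose a negative entry in every row and a positive one in every column; following these
  choices alternately leads into a cycle, whose rows and columns form a square mixed submatrix.\<close>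

lemma dominating_nonneg_row:
  fixes M :: "real^'s::finite^'r::finite"
  assumes dom: "dominating M" and "I \<noteq> {}"
    and pos: "\<And>j. j \<in> J \<Longrightarrow> \<exists>i\<in>I. s j * M $ i $ j > 0"
  shows "\<exists>i\<in>I. \<forall>j\<in>J. s j * M $ i $ j \<ge> 0"
proof (rule ccontr)
  assume "\<not> ?thesis"
  then obtain \<sigma> where \<sigma>: "\<And>i. i \<in> I \<Longrightarrow> \<sigma> i \<in> J \<and> s (\<sigma> i) * M $ i $ \<sigma> i < 0"
    by (metis not_le)
  obtain \<tau> where \<tau>: "\<And>j. j \<in> J \<Longrightarrow> \<tau> j \<in> I \<and> s j * M $ \<tau> j $ j > 0"
    using pos by metis
  define f where "f = \<sigma> \<circ> \<tau>"
  \<comment> \<open>A minimal nonempty \<open>f\<close>-invariant set plays the role of the cycle: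
    \<open>f\<close> permutes it, so \<open>\<tau>\<close> is injective on it and the submatrix is
    square.\<close>
  define S where "S = {K. K \<noteq> {} \<and> K \<subseteq> J \<and> f ` K \<subseteq> K}"
  have "J \<in> S"
    unfolding S_def f_def using \<open>I \<noteq> {}\<close> \<sigma> \<tau> by fastforce
  moreover have "finite S" by simp
  ultimately obtain K where "K \<in> S" and min: "\<And>L. L \<in> S \<Longrightarrow> L \<subseteq> K \<Longrightarrow> K = L"
    using finite_has_minimal[of S] by blast
  then have K: "K \<noteq> {}" "K \<subseteq> J" "f ` K \<subseteq> K"
    by (auto simp: S_def)
  then have "f ` K \<in> S"
    unfolding S_def by blast
  with min K have fK: "f ` K = K" by metis
  then have "inj_on f K"
    by (simp add: eq_card_imp_inj_on)
  then have "inj_on \<tau> K"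
    unfolding f_def by (rule inj_on_imageI2)
  then have "card (\<tau> ` K) = card K"
    by (rule card_image)
  moreover have "mixed_on (\<tau> ` K) K M"
    unfolding mixed_on_def
  proof
    fix j assume j: "j \<in> K"
    with fK obtain j' where j': "j' \<in> K" "j = \<sigma> (\<tau> j')"
      unfolding f_def by auto
    \<comment> \<open>The entry chosen in column \<open>j\<close> and the entry whose row chose
      column \<open>j\<close> have opposite signs, whatever the sign of \<open>s j\<close>.\<close>
    have "s j * M $ \<tau> j $ j > 0" "s j * M $ \<tau> j' $ j < 0"
      using \<tau>[of j] \<tau>[of j'] \<sigma>[of "\<tau> j'"] j j' K(2) by auto
    then show "(\<exists>i\<in>\<tau> ` K. M $ i $ j > 0) \<and> (\<exists>i\<in>\<tau> ` K. M $ i $ j < 0)"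
      using j j'(1) by (auto simp: zero_less_mult_iff mult_less_0_iff)
  qed
  ultimately show False
    using dom K(1) unfolding dominating_def by (metis image_is_empty)
qed

text \<open>The row lemma with signs \<open>- y $ j\<close> on the support of \<open>y\<close>
  yields a row of \<open>M *v y\<close> without positive terms. This is what makes the positive
  region around \<open>u\<close> bounded.\<close>

lemma dominating_mixed_negative_entry:
  fixes M :: "real^'s::finite^'r::finite"
  assumes dom: "dominating M" and mix: "mixed_on UNIV UNIV M" and "y \<noteq> 0"
  shows "\<exists>i. (M *v y) $ i < 0"
proof -
  define J where "J = {j. y $ j \<noteq> 0}"
  \<comment> \<open>Restricting to rows that meet the support of \<open>y\<close> ensures that the
    row found has a nonzero term, so its sum is strict.\<close>
  define I where "I = {i. \<exists>j\<in>J. M $ i $ j \<noteq> 0}"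
  have pos: "\<exists>i\<in>I. - y $ j * M $ i $ j > 0" if "j \<in> J" for j
  proof -
    obtain i i' where "M $ i $ j > 0" "M $ i' $ j < 0"
      using mix unfolding mixed_on_def by blast
    moreover from this that have "i \<in> I" "i' \<in> I"
      unfolding I_def by force+
    moreover have "y $ j \<noteq> 0"
      using that by (simp add: J_def)
    ultimately show ?thesis
      by (cases "y $ j > 0") (force simp: mult_less_0_iff)+
  qed
  moreover have "J \<noteq> {}"
    using \<open>y \<noteq> 0\<close> by (auto simp: J_def vec_eq_iff)
  ultimately have "I \<noteq> {}" by blast
  from dominating_nonneg_row[OF dom this pos] obtain i
    where i: "i \<in> I" "\<And>j. j \<in> J \<Longrightarrow> - y $ j * M $ i $ j \<ge> 0" by blast
  then obtain j where j: "j \<in> J" "M $ i $ j \<noteq> 0"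
    by (auto simp: I_def)
  have "(\<Sum>j\<in>UNIV. - y $ j * M $ i $ j) > 0"
  proof (rule sum_pos2)
    show "- y $ j * M $ i $ j > 0"
      using i(2)[of j] j by (auto simp: J_def less_le)
    show "0 \<le> - y $ j' * M $ i $ j'" for j'
      using i(2)[of j'] by (cases "j' \<in> J") (auto simp: J_def)
  qed auto
  then have "(M *v y) $ i < 0"
    by (simp add: matrix_vector_mult_def sum_negf mult.commute)
  then show ?thesis ..
qed

text \<open>Otherwise every column with a negative product on \<open>I\<close> also has a positive
  one. The row lemma handles the columns with a positive product, and all others vanish on
  \<open>I\<close>, so some row in \<open>I\<close> has a nonnegative sum.\<close>

lemma dominating_outward_column:
  fixes M :: "real^'s::finite^'r::finite"
  assumes dom: "dominating M" and "I \<noteq> {}"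
    and neg: "\<And>i. i \<in> I \<Longrightarrow> (M *v y) $ i < 0"
  shows "\<exists>j. (\<forall>i\<in>I. y $ j * M $ i $ j \<le> 0) \<and> (\<exists>i\<in>I. y $ j * M $ i $ j < 0)"
proof (rule ccontr)
  assume no: "\<not> ?thesis"
  define J where "J = {j. \<exists>i\<in>I. y $ j * M $ i $ j > 0}"
  obtain i where i: "i \<in> I" "\<And>j. j \<in> J \<Longrightarrow> y $ j * M $ i $ j \<ge> 0"
    using dominating_nonneg_row[OF dom \<open>I \<noteq> {}\<close>, of J "\<lambda>j. y $ j"] unfolding J_def by blast
  have "y $ j * M $ i $ j \<ge> 0" for j
  proof (cases "j \<in> J")
    case False
    then have "\<forall>i\<in>I. y $ j * M $ i $ j \<le> 0"
      by (auto simp: J_def not_less)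
    with no i(1) show ?thesis
      by (meson not_le)
  qed (use i(2) in blast)
  then have "(M *v y) $ i \<ge> 0"
    by (simp add: matrix_vector_mult_def sum_nonneg mult.commute)
  with neg[OF i(1)] show False by simp
qed

section \<open>Brouwer's theorem on gauge balls\<close>

text \<open>Brouwer's theorem for \<open>y - g y\<close> followed by the radial retraction onto the unit ball of the
  gauge \<open>p\<close>.\<close>

lemma gauge_ball_zero_or_inward:
  fixes g :: "'a::euclidean_space \<Rightarrow> 'a" and p :: "'a \<Rightarrow> real"
  assumes contp: "continuous_on UNIV p" and conv: "convex_on UNIV p"
    and hom: "\<And>c y. c \<ge> 0 \<Longrightarrow> p (c *\<^sub>R y) = c * p y"
    and bdd: "bounded {y. p y \<le> 1}"
    and contg: "continuous_on {y. p y \<le> 1} g"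
  obtains y c where "p y \<le> 1" "c \<ge> 0" "g y = - c *\<^sub>R y" "c = 0 \<or> p y = 1"
proof -
  define K where "K = {y. p y \<le> 1}"
  define r where "r = (\<lambda>z. (1 / max 1 (p z)) *\<^sub>R z)"
  have "closed K"
    unfolding K_def using contp by (intro closed_Collect_le) auto
  with bdd have "compact K"
    by (simp add: K_def compact_eq_bounded_closed)
  moreover have "convex K"
  proof (rule convexI)
    fix x y u v :: _ assume "x \<in> K" "y \<in> K" and uv: "(0::real) \<le> u" "0 \<le> v" "u + v = 1"
    have "p (u *\<^sub>R x + v *\<^sub>R y) \<le> u * p x + v * p y"
      using conv uv by (auto simp: convex_on_def)
    also have "\<dots> \<le> u * 1 + v * 1"
      using \<open>x \<in> K\<close> \<open>y \<in> K\<close> uv by (intro add_mono mult_left_mono) (auto simp: K_def)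
    finally show "u *\<^sub>R x + v *\<^sub>R y \<in> K"
      using uv by (simp add: K_def)
  qed
  moreover have "0 \<in> K"
    using hom[of 0 0] by (simp add: K_def)
  then have "K \<noteq> {}" by blast
  moreover have rK: "r z \<in> K" for z
    by (auto simp: K_def r_def hom divide_simps)
  moreover have "continuous_on K (r \<circ> (\<lambda>y. y - g y))"
  proof (rule continuous_on_compose)
    show "continuous_on K (\<lambda>y. y - g y)"
      using contg unfolding K_def by (intro continuous_intros)
    have "continuous_on UNIV r"
      unfolding r_def by (intro continuous_intros contp) (auto simp: max_def)
    then show "continuous_on ((\<lambda>y. y - g y) ` K) r"
      using continuous_on_subset by blast
  qed
  ultimately obtain y where y: "y \<in> K" "r (y - g y) = y"
    using brouwer[of K "r \<circ> (\<lambda>y. y - g y)"] by auto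
  define m where "m = max 1 (p (y - g y))"
  have "m \<ge> 1" by (simp add: m_def)
  \<comment> \<open>\<open>r\<close> only divides by \<open>m\<close>, so the fixed point equation
    becomes \<open>y - g y = m *\<^sub>R y\<close>.\<close>
  have "y - g y = m *\<^sub>R r (y - g y)"
    using \<open>m \<ge> 1\<close> by (simp add: r_def flip: m_def)
  then have z: "y - g y = m *\<^sub>R y" using y by simp
  show thesis
  proof (rule that)
    show "p y \<le> 1" using y by (simp add: K_def)
    show "m - 1 \<ge> 0" using \<open>m \<ge> 1\<close> by simp
    show "g y = - (m - 1) *\<^sub>R y"
      using z by (simp add: algebra_simps)
    show "m - 1 = 0 \<or> p y = 1"
    proof (cases "m = 1")
      \<comment> \<open>For \<open>m > 1\<close> the retraction really shrinks its argument, so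
        \<open>p (y - g y) = m\<close>, while homogeneity gives \<open>m * p y\<close>.\<close>
      case False
      with \<open>m \<ge> 1\<close> have "p (y - g y) = m" by (auto simp: m_def max_def split: if_splits)
      moreover have "p (y - g y) = m * p y"
        unfolding z using \<open>m \<ge> 1\<close> by (simp add: hom)
      ultimately show ?thesis using \<open>m \<ge> 1\<close> by simp
    qed simp
  qed
qed

text \<open>By compactness \<open>p\<close> has a positive minimum on the unit sphere, and
  homogeneity turns it into a lower bound for \<open>p\<close> linear in the norm.\<close>

lemma homogeneous_sublevel_bounded:
  fixes p :: "'a::euclidean_space \<Rightarrow> real"
  assumes contp: "continuous_on UNIV p"
    and hom: "\<And>c y. c \<ge> 0 \<Longrightarrow> p (c *\<^sub>R y) = c * p y"
    and pos: "\<And>y. y \<noteq> 0 \<Longrightarrow> p y > 0"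
  shows "bounded {y. p y \<le> b}"
proof -
  have "sphere (0::'a) 1 \<noteq> {}" by simp
  moreover have "continuous_on (sphere 0 1) p"
    using contp by (rule continuous_on_subset) simp
  ultimately obtain u where "u \<in> sphere 0 1" "\<forall>y\<in>sphere 0 1. p u \<le> p y"
    using continuous_attains_inf[OF compact_sphere] by blast
  then have u: "norm u = 1" "\<And>y. norm y = 1 \<Longrightarrow> p u \<le> p y"
    by auto
  have "p u > 0" using u(1) by (intro pos) auto
  have "norm y \<le> max 0 (b / p u)" if "p y \<le> b" for y
  proof (cases "y = 0")
    case False
    have "p u * norm y \<le> p (sgn y) * norm y"
      using False by (intro mult_right_mono u(2)) (auto simp: norm_sgn)
    also have "\<dots> = p (norm y *\<^sub>R sgn y)" by (simp add: hom)
    also have "norm y *\<^sub>R sgn y = y" using False by (simp add: sgn_div_norm)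
    finally show ?thesis
      using that \<open>p u > 0\<close> by (simp add: field_simps le_max_iff_disj)
  qed simp
  then show ?thesis
    unfolding bounded_iff by blast
qed

section \<open>Solvability of the logarithmic system\<close>

lemma sum_filterlim_at_top:
  fixes f :: "'i \<Rightarrow> 'a \<Rightarrow> real"
  assumes "finite S" "i \<in> S" and top: "filterlim (f i) at_top F"
    and below: "\<And>k. k \<in> S \<Longrightarrow> k \<noteq> i \<Longrightarrow> \<exists>b. eventually (\<lambda>x. b \<le> f k x) F"
  shows "filterlim (\<lambda>x. \<Sum>k\<in>S. f k x) at_top F"
proof -
  obtain b where b: "\<And>k. k \<in> S - {i} \<Longrightarrow> eventually (\<lambda>x. b k \<le> f k x) F"
    using below by (metis DiffE insertCI)
  have "filterlim (\<lambda>x. sum b (S - {i}) + f i x) at_top F"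
    by (rule filterlim_tendsto_add_at_top[OF tendsto_const top])
  moreover have "eventually (\<lambda>x. \<forall>k\<in>S - {i}. b k \<le> f k x) F"
    using assms(1) b by (intro eventually_ball_finite) auto
  then have "eventually (\<lambda>x. sum b (S - {i}) + f i x \<le> (\<Sum>k\<in>S. f k x)) F"
    by eventually_elim (use assms(1,2) in \<open>auto simp: sum.remove intro!: sum_mono\<close>)
  ultimately show ?thesis
    by (rule filterlim_at_top_mono)
qed

lemma dominating_log_system_solvable:
  fixes B W :: "real^'k::finite^'n::finite" and u :: "real^'n"
  assumes domB: "dominating B" and mixB: "mixed_on UNIV UNIV B"
    and sgn_eq: "\<And>i j. sgn (W $ i $ j) = sgn (B $ i $ j)"
    and u: "\<And>i. u $ i > 0"
  shows "\<exists>y. (\<forall>i. (u + W *v y) $ i > 0) \<and> (\<forall>j. (\<Sum>i\<in>UNIV. B $ i $ j * ln ((u + W *v y) $ i)) = 0)"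
proof (rule ccontr)
  assume no: "\<not> ?thesis"
  have same: "W $ i $ j > 0 \<longleftrightarrow> B $ i $ j > 0" "W $ i $ j < 0 \<longleftrightarrow> B $ i $ j < 0" for i j
    using sgn_eq[of i j] by (metis sgn_greater) (metis sgn_eq sgn_less)
  \<comment> \<open>Domination and mixedness depend only on the signs of the entries.\<close>
  have domW: "dominating W" and mixW: "mixed_on UNIV UNIV W"
    using domB mixB unfolding dominating_def mixed_on_def same by auto
  \<comment> \<open>The gauge of the region: \<open>u + W *v y\<close> is positive exactly when
    \<open>p y < 1\<close>.\<close>
  define p where "p = (\<lambda>y. Max (range (\<lambda>i. - (W *v y) $ i / u $ i)))"
  have p_le: "p y \<le> c \<longleftrightarrow> (\<forall>i. - (W *v y) $ i \<le> c * u $ i)" for y c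
    unfolding p_def using u by (subst Max_le_iff) (auto simp: field_simps)
  have p_less: "p y < c \<longleftrightarrow> (\<forall>i. - (W *v y) $ i < c * u $ i)" for y c
    unfolding p_def using u by (subst Max_less_iff) (auto simp: field_simps)
  have p_hom: "p (c *\<^sub>R y) = c * p y" if "c \<ge> 0" for c y
  proof -
    have "c * p y = Max ((*) c ` range (\<lambda>i. - (W *v y) $ i / u $ i))"
      unfolding p_def using that
      by (intro mono_Max_commute) (auto simp: mono_def mult_left_mono)
    then show ?thesis
      by (simp add: p_def image_image matrix_vector_mult_scaleR)
  qed
  have W_cont: "continuous_on S (\<lambda>y. (W *v y) $ i)" for S i
    by (intro linear_continuous_on bounded_linear_compose[OF bounded_linear_vec_nth]
        matrix_vector_mul_bounded_linear)
  have p_cont: "continuous_on UNIV p"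
  proof -
    have "continuous_on UNIV (\<lambda>y. Max ((\<lambda>i. - (W *v y) $ i / u $ i) ` A))"
      if "finite A" "A \<noteq> {}" for A
      using that
    proof (induction rule: finite_ne_induct)
      case (singleton i)
      then show ?case using u[of i]
        by (auto intro!: continuous_intros W_cont)
    next
      case (insert i A)
      have "continuous_on UNIV (\<lambda>y. - (W *v y) $ i / u $ i)" using u[of i]
        by (auto intro!: continuous_intros W_cont)
      with insert show ?case
        by (auto intro!: continuous_on_max)
    qed
    then show ?thesis unfolding p_def by simp
  qed
  have p_conv: "convex_on UNIV p"
  proof (rule convex_onI)
    fix t :: real and x y :: "real^'k" assume t: "0 < t" "t < 1"
    have "- (W *v ((1 - t) *\<^sub>R x + t *\<^sub>R y)) $ i \<le> ((1 - t) * p x + t * p y) * u $ i" for i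
    proof -
      have "(1 - t) * (- (W *v x) $ i) + t * (- (W *v y) $ i) \<le> (1 - t) * (p x * u $ i) + t * (p y * u $ i)"
        using t p_le[of x "p x"] p_le[of y "p y"] by (intro add_mono mult_left_mono) auto
      then show ?thesis
        by (simp add: matrix_vector_right_distrib matrix_vector_mult_scaleR algebra_simps)
    qed
    then show "p ((1 - t) *\<^sub>R x + t *\<^sub>R y) \<le> (1 - t) * p x + t * p y"
      by (simp add: p_le)
  qed simp
  have p_pos: "p y > 0" if y: "y \<noteq> 0" for y
  proof -
    obtain i where "(W *v y) $ i < 0"
      using dominating_mixed_negative_entry[OF domW mixW y] by blast
    then have "\<not> - (W *v y) $ i \<le> 0 * u $ i" by simp
    then have "\<not> p y \<le> 0"
      using p_le by blast
    then show ?thesis by simp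
  qed
  note bdd = homogeneous_sublevel_bounded[OF p_cont p_hom p_pos]
  define v where "v = (\<lambda>y. u + W *v y)"
  have v_pos: "v y $ i > 0" if "p y < 1" for y i
  proof -
    have "- (W *v y) $ i < 1 * u $ i"
      using that p_less by blast
    then show ?thesis by (simp add: v_def)
  qed
  have v_cont: "continuous_on S (\<lambda>y. v y $ i)" for S i
    unfolding v_def
    by (auto intro!: continuous_intros W_cont)
  define g where "g = (\<lambda>y. \<chi> j. \<Sum>i\<in>UNIV. B $ i $ j * ln (v y $ i))"
  have nz: "g y \<noteq> 0" if "p y < 1" for y
    using no v_pos[OF that] unfolding g_def v_def by (auto simp: vec_eq_iff)
  \<comment> \<open>The logarithms blow up at \<open>p y = 1\<close>, so Brouwer's theorem is
    applied on smaller balls exhausting the region. The double \<open>Suc\<close> starts the radii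
    at \<open>1 / 2\<close>, which keeps them positive.\<close>
  define \<rho> where "\<rho> = (\<lambda>m. 1 + - inverse (real (Suc (Suc m))))"
  have \<rho>: "0 < \<rho> m" "\<rho> m < 1" for m
    by (auto simp: \<rho>_def field_simps)
  have "\<exists>y c. p y = \<rho> m \<and> c \<ge> 0 \<and> g y = - c *\<^sub>R y" for m
  proof -
    have eq: "{y. p y / \<rho> m \<le> 1} = {y. p y \<le> \<rho> m}"
      using \<rho>[of m] by (auto simp: field_simps)
    have "\<forall>y\<in>{y. p y \<le> \<rho> m}. v y $ i \<noteq> 0" for i
    proof clarify
      fix y assume "p y \<le> \<rho> m" "v y $ i = 0"
      moreover from this \<rho>(2) have "p y < 1" by (meson order_le_less_trans)
      ultimately show False using v_pos[of y i] by simp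
    qed
    then have g_cont: "continuous_on {y. p y \<le> \<rho> m} g"
      unfolding g_def
      by (intro continuous_on_vec_lambda continuous_on_sum continuous_on_mult continuous_on_const
          continuous_on_ln v_cont)
    have "convex_on UNIV (\<lambda>y. p y / \<rho> m)"
      using convex_on_cmul[OF _ p_conv, of "1 / \<rho> m"] \<rho>[of m] by simp
    moreover have "continuous_on UNIV (\<lambda>y. p y / \<rho> m)"
      using \<rho>[of m] by (intro continuous_intros p_cont) auto
    ultimately obtain y c where yc: "p y / \<rho> m \<le> 1" "c \<ge> 0" "g y = - c *\<^sub>R y"
        "c = 0 \<or> p y / \<rho> m = 1"
      using gauge_ball_zero_or_inward[of "\<lambda>y. p y / \<rho> m" g, unfolded eq, OF _ _ _ bdd g_cont]
      by (auto simp: p_hom)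
    \<comment> \<open>\<open>c = 0\<close> would give a zero of \<open>g\<close> inside the region,
      excluded by \<open>nz\<close>.\<close>
    have "c \<noteq> 0"
      using nz[of y] yc \<rho>[of m] by (auto simp: field_simps)
    then have "p y = \<rho> m"
      using yc \<rho>[of m] by simp
    with yc show ?thesis by blast
  qed
  then obtain Y c where Y: "\<And>m. p (Y m) = \<rho> m" "\<And>m. c m \<ge> 0" "\<And>m. g (Y m) = - c m *\<^sub>R Y m"
    by metis
  have "bounded (range Y)"
    using bdd[of 1] by (rule bounded_subset) (auto simp: Y(1) \<rho>(2) less_imp_le)
  then obtain y \<phi> where \<phi>: "strict_mono \<phi>" and "(Y \<circ> \<phi>) \<longlonglongrightarrow> y"
    using bounded_imp_convergent_subsequence by blast
  define z where "z = (\<lambda>m. Y (\<phi> m))"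
  have lim: "z \<longlonglongrightarrow> y"
    using \<open>(Y \<circ> \<phi>) \<longlonglongrightarrow> y\<close> by (simp add: z_def o_def)
  have "(\<lambda>m. p (z m)) \<longlonglongrightarrow> p y"
    by (rule continuous_on_tendsto_compose[OF p_cont lim]) auto
  moreover have "\<rho> \<longlonglongrightarrow> 1"
    unfolding \<rho>_def by (rule LIMSEQ_Suc[OF LIMSEQ_inverse_real_of_nat_add_minus])
  then have "(\<lambda>m. p (z m)) \<longlonglongrightarrow> 1"
    using LIMSEQ_subseq_LIMSEQ[OF _ \<phi>] by (auto simp: z_def Y(1) o_def)
  ultimately have py: "p y = 1"
    by (rule LIMSEQ_unique)
  have v_ge: "v y $ i \<ge> 0" for i
  proof -
    have "- (W *v y) $ i \<le> 1 * u $ i"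
      using py p_le by (metis order_refl)
    then show ?thesis by (simp add: v_def)
  qed
  \<comment> \<open>The limit point has \<open>p y = 1\<close>, so some coordinate of
    \<open>v y\<close> vanishes. On such coordinates \<open>W *v y\<close> equals
    \<open>- u\<close>, hence is negative as \<open>dominating_outward_column\<close>
    requires.\<close>
  define I where "I = {i. v y $ i = 0}"
  have "I \<noteq> {}"
  proof -
    have "\<not> p y < 1" using py by simp
    then obtain i where "- (W *v y) $ i \<ge> 1 * u $ i"
      using p_less by (auto simp: not_less)
    then have "v y $ i = 0"
      using v_ge[of i] by (simp add: v_def)
    then show ?thesis by (auto simp: I_def)
  qed
  moreover have "(W *v y) $ i < 0" if "i \<in> I" for i
    using that u[of i] by (simp add: I_def v_def)
  ultimately obtain j i0 where j: "\<And>i. i \<in> I \<Longrightarrow> y $ j * W $ i $ j \<le> 0"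
      and i0: "i0 \<in> I" "y $ j * W $ i0 $ j < 0"
    using dominating_outward_column[OF domW, of I y] by blast
  \<comment> \<open>The column was found for \<open>W\<close>, but the logarithms are weighted by
    \<open>B\<close>; equal signs carry the inequalities over.\<close>
  have sgn_eq': "sgn (y $ j * W $ i $ j) = sgn (y $ j * B $ i $ j)" for i
    by (simp add: sgn_mult sgn_eq)
  have j': "y $ j * B $ i $ j \<le> 0" if "i \<in> I" for i
    using j[OF that] sgn_eq'[of i] by (metis not_le sgn_greater)
  have i0': "y $ j * B $ i0 $ j < 0"
    using i0(2) sgn_eq'[of i0] by (metis sgn_less)
  have v_lim: "(\<lambda>m. v (z m) $ i) \<longlonglongrightarrow> v y $ i" for i
    by (rule continuous_on_tendsto_compose[OF v_cont[of UNIV] lim]) auto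
  have vz_pos: "v (z m) $ i > 0" for m i
    using v_pos Y(1) \<rho>(2) by (simp add: z_def)
  have ln_bot: "filterlim (\<lambda>m. ln (v (z m) $ i)) at_bot sequentially" if "i \<in> I" for i
  proof -
    have "filterlim (\<lambda>m. v (z m) $ i) (at_right 0) sequentially"
      using v_lim[of i] that vz_pos[of _ i] less_imp_neq[OF vz_pos[of _ i]]
      by (auto simp: I_def filterlim_at)
    then show ?thesis
      using ln_at_0 filterlim_compose by blast
  qed
  \<comment> \<open>On \<open>I\<close> the weights are nonpositive, strictly so at
    \<open>i0\<close>, and the logarithms tend to minus infinity; outside \<open>I\<close> the terms
    converge.\<close>
  have "filterlim (\<lambda>m. \<Sum>i\<in>UNIV. (y $ j * B $ i $ j) * ln (v (z m) $ i)) at_top sequentially"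
  proof (rule sum_filterlim_at_top[of _ i0])
    show "filterlim (\<lambda>m. (y $ j * B $ i0 $ j) * ln (v (z m) $ i0)) at_top sequentially"
      using filterlim_tendsto_pos_mult_at_top[OF tendsto_const[of "- (y $ j * B $ i0 $ j)"] _
          ln_bot[OF i0(1), unfolded filterlim_uminus_at_bot]] i0' by simp
    show "\<exists>b. \<forall>\<^sub>F m in sequentially. b \<le> (y $ j * B $ i $ j) * ln (v (z m) $ i)" for i
    proof (cases "i \<in> I")
      case True
      have "\<forall>\<^sub>F m in sequentially. ln (v (z m) $ i) \<le> 0"
        using ln_bot[OF True] by (auto simp: filterlim_at_bot)
      then have "\<forall>\<^sub>F m in sequentially. 0 \<le> (y $ j * B $ i $ j) * ln (v (z m) $ i)"
        by eventually_elim (use j'[OF True] in \<open>rule mult_nonpos_nonpos\<close>)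
      then show ?thesis ..
    next
      case False
      then have "(\<lambda>m. (y $ j * B $ i $ j) * ln (v (z m) $ i)) \<longlonglongrightarrow> (y $ j * B $ i $ j) * ln (v y $ i)"
        by (intro tendsto_intros v_lim) (auto simp: I_def)
      then have "\<forall>\<^sub>F m in sequentially.
          (y $ j * B $ i $ j) * ln (v y $ i) - 1 < (y $ j * B $ i $ j) * ln (v (z m) $ i)"
        by (rule order_tendstoD) simp
      then show ?thesis
        using eventually_mono less_imp_le by meson
    qed
  qed auto
  then have "\<forall>\<^sub>F m in sequentially. 0 < (\<Sum>i\<in>UNIV. (y $ j * B $ i $ j) * ln (v (z m) $ i))"
    by (auto simp: filterlim_at_top_dense)
  \<comment> \<open>The weight is the coordinate \<open>y $ j\<close> of the limit, whereas
    \<open>g (z m)\<close> is a multiple of \<open>z m\<close>. As \<open>y $ j\<close> is nonzero,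
    both coordinates eventually have the same sign.\<close>
  moreover have "(\<lambda>m. y $ j * z m $ j) \<longlonglongrightarrow> y $ j * y $ j"
    by (intro tendsto_intros lim)
  moreover have "y $ j \<noteq> 0" using i0' by auto
  then have "y $ j * y $ j > 0" by (simp add: zero_less_mult_iff) linarith
  ultimately have "\<forall>\<^sub>F m in sequentially. 0 < (\<Sum>i\<in>UNIV. (y $ j * B $ i $ j) * ln (v (z m) $ i))
      \<and> 0 < y $ j * z m $ j"
    by (intro eventually_conj) (auto dest: order_tendstoD)
  then obtain m where m: "0 < (\<Sum>i\<in>UNIV. (y $ j * B $ i $ j) * ln (v (z m) $ i))" "0 < y $ j * z m $ j"
    using eventually_happens by force
  have "(\<Sum>i\<in>UNIV. (y $ j * B $ i $ j) * ln (v (z m) $ i)) = y $ j * g (z m) $ j"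
    by (simp add: g_def sum_distrib_left mult.assoc)
  also have "\<dots> = - c (\<phi> m) * (y $ j * z m $ j)"
    by (simp add: z_def Y(3))
  also have "\<dots> \<le> 0"
    using m(2) Y(2) by simp
  finally show False
    using m(1) by simp
qed

section \<open>Gale duality and the passage from logarithms to monomials\<close>

text \<open>The kernel is the orthogonal complement of the row space, and in finite dimension the
  row space is its own double complement.\<close>

lemma orthogonal_null_space_row_combination:
  fixes A :: "real^'n::finite^'m::finite"
  assumes "\<And>w. A *v w = 0 \<Longrightarrow> w \<bullet> x = 0"
  obtains z where "x = transpose A *v z"
proof -
  have "adjoint ((*v) A) = (*v) (transpose A)"
    using adjoint_matrix by blast
  then have "(range ((*v) (transpose A)))\<^sup>\<bottom> = {w. A *v w = 0}"
    using ker_orthogonal_comp_adjoint[OF matrix_vector_mul_linear, of A] by (auto simp: vimage_def)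
  moreover have "x \<in> {w. A *v w = 0}\<^sup>\<bottom>"
    using assms by (auto simp: orthogonal_comp_def orthogonal_def)
  moreover have "(range ((*v) (transpose A)))\<^sup>\<bottom>\<^sup>\<bottom> = range ((*v) (transpose A))"
    by (intro orthogonal_comp_self linear_subspace_image matrix_vector_mul_linear subspace_UNIV)
  ultimately have "x \<in> range ((*v) (transpose A))"
    by simp
  then show thesis
    using that by blast
qed

lemma gale_dual_column_in_kernel:
  assumes "gale_dual M N"
  shows "M *v column j N = 0" 
proof -
  have "column j N \<in> span (columns N)"
    by (auto intro: span_base simp: columns_def)
  then show ?thesis
    using assms by (simp add: gale_dual_def)
qed

text \<open>The row of ones makes every column of \<open>B\<close> sum to zero, and independence
  makes it nonzero, so both signs occur.\<close>

lemma gale_dual_exponent_matrix_mixed: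
  assumes "gale_dual (exponent_matrix a) (B :: real^'k::finite^'n::finite)"
  shows "mixed_on UNIV UNIV B"
proof -
  have "(\<exists>i. B $ i $ j > 0) \<and> (\<exists>i. B $ i $ j < 0)" for j
  proof -
    have sum0: "(\<Sum>i\<in>UNIV. B $ i $ j) = 0"
      using gale_dual_column_in_kernel[OF assms, of j]
      by (auto simp: vec_eq_iff matrix_vector_mult_def exponent_matrix_def column_def
          dest: spec[of _ None])
    have "column j B \<noteq> 0"
      using assms dependent_zero[of "columns B"] by (auto simp: gale_dual_def columns_def)
    then obtain i where i: "B $ i $ j \<noteq> 0"
      by (auto simp: column_def vec_eq_iff)
    have "\<not> (\<forall>i. B $ i $ j \<ge> 0)"
    proof
      assume "\<forall>i. B $ i $ j \<ge> 0"
      then have "B $ i $ j = 0"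
        by (intro sum_nonneg_0[OF _ _ sum0]) auto
      with i show False ..
    qed
    moreover have "\<not> (\<forall>i. B $ i $ j \<le> 0)"
    proof
      have neg0: "(\<Sum>i\<in>UNIV. - B $ i $ j) = 0"
        using sum0 by (simp add: sum_negf)
      assume "\<forall>i. B $ i $ j \<le> 0"
      then have "- B $ i $ j = 0"
        by (intro sum_nonneg_0[OF _ _ neg0]) auto
      with i show False by simp
    qed
    ultimately show ?thesis by (simp add: not_le)
  qed
  then show ?thesis by (simp add: mixed_on_def)
qed

text \<open>The logarithm of \<open>v\<close> is orthogonal to the whole kernel of the exponent
  matrix, hence a combination of its rows; exponentiating shows that \<open>v\<close> is a positive
  multiple of a vector of monomials.\<close>

lemma positive_solution_from_log_system:
  fixes a :: "'n::finite \<Rightarrow> real^'d::finite" and C :: "real^'n^'d" and B :: "real^'k::finite^'n"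
  assumes gale: "gale_dual (exponent_matrix a) B" and ker: "C *v v = 0"
    and pos: "\<And>i. v $ i > 0"
    and log: "\<And>j. (\<Sum>i\<in>UNIV. B $ i $ j * ln (v $ i)) = 0"
  shows "positive_solutions a C \<noteq> {}"
proof -
  define l where "l = (\<chi> i. ln (v $ i))"
  have "w \<bullet> l = 0" if "exponent_matrix a *v w = 0" for w
  proof -
    have "w \<in> span (columns B)"
      using that gale by (auto simp: gale_dual_def)
    moreover have "orthogonal l b" if "b \<in> columns B" for b
      using that log
      by (auto simp: columns_def column_def orthogonal_def inner_vec_def l_def mult.commute)
    ultimately have "orthogonal l w"
      using orthogonal_to_span by blast
    then show ?thesis by (simp add: orthogonal_def inner_commute)
  qed
  then obtain z where z: "l = transpose (exponent_matrix a) *v z"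
    by (rule orthogonal_null_space_row_combination)
  \<comment> \<open>The coordinates \<open>Some k\<close> are the logarithms of the solution. The
    coordinate \<open>None\<close> gives a common factor, which cancels from the equations.\<close>
  define x where "x = (\<chi> k. exp (z $ Some k))"
  have v: "v $ i = exp (z $ None) * monomial x (a i)" for i
  proof -
    have "ln (v $ i) = (\<Sum>k\<in>UNIV. exponent_matrix a $ k $ i * z $ k)"
      using arg_cong[OF z, of "\<lambda>l. l $ i"]
      by (simp add: l_def matrix_vector_mult_def transpose_def)
    also have "\<dots> = z $ None + (\<Sum>k\<in>UNIV. a i $ k * z $ Some k)"
      by (simp add: UNIV_option_conv sum.reindex exponent_matrix_def)
    finally have "exp (ln (v $ i)) = exp (z $ None) * exp (\<Sum>k\<in>UNIV. a i $ k * z $ Some k)"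
      by (simp add: exp_add)
    then show ?thesis
      using pos[of i] by (simp add: monomial_def x_def exp_sum powr_def)
  qed
  have "(\<Sum>j\<in>UNIV. C $ i $ j * monomial x (a j)) = 0" for i
  proof -
    have "0 = (C *v v) $ i" by (simp add: ker)
    also have "\<dots> = exp (z $ None) * (\<Sum>j\<in>UNIV. C $ i $ j * monomial x (a j))"
      by (simp add: matrix_vector_mult_def v sum_distrib_left mult_ac)
    finally show ?thesis by simp
  qed
  then have "x \<in> positive_solutions a C"
    by (simp add: positive_solutions_def x_def)
  then show ?thesis by blast
qed

theorem theorem4p6:
  fixes a :: "'n::finite \<Rightarrow> real^'d::finite"
    and C :: "real^'n^'d"
    and B :: "real^'k::finite^'n"
  assumes "CARD('n) \<ge> CARD('d) + 2"
    and "CARD('k) = CARD('n) - CARD('d) - 1"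
    and "inj a"
    and "uniform_matrix (exponent_matrix a)"
    and "uniform_matrix C"
    and "gale_dual (exponent_matrix a) B"
    and "dominating B"
    and "0 \<in> open_column_cone C"
    and "\<forall>j. sign_vec (column j B) \<in> sign_vec ` {v. C *v v = 0}"
  shows "num_positive_solutions a C > 0"
proof -
  obtain w where w: "\<And>j. sign_vec (column j B) = sign_vec (w j)" "\<And>j. C *v w j = 0"
    using assms(9) by (simp add: image_iff) metis
  define W :: "real^'k^'n" where "W = (\<chi> i j. w j $ i)"
  have sgn_eq: "sgn (W $ i $ j) = sgn (B $ i $ j)" for i j
    using w(1)[of j] by (simp add: sign_vec_def vec_eq_iff column_def W_def)
  obtain t where t: "0 = (\<Sum>j\<in>UNIV. t j *\<^sub>R column j C)" "\<And>j. t j > 0"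
    using assms(8) by (auto simp: open_column_cone_def)
  \<comment> \<open>The positive coefficients representing \<open>0\<close> in the open cone form a
    vector in the kernel of \<open>C\<close>.\<close>
  define u where "u = (\<chi> i. t i)"
  have "C *v u = 0"
    using t(1) by (simp add: matrix_mult_sum u_def scalar_mult_eq_scaleR)
  moreover have "C *v (W *v y) = 0" for y
  proof -
    have "column j W = w j" for j
      by (simp add: column_def W_def vec_eq_iff)
    then have "W *v y = (\<Sum>j\<in>UNIV. y $ j *\<^sub>R w j)"
      by (simp add: matrix_mult_sum scalar_mult_eq_scaleR)
    then show ?thesis
      by (simp add: linear_sum[OF matrix_vector_mul_linear] matrix_vector_mult_scaleR w(2))
  qed
  ultimately have ker: "C *v (u + W *v y) = 0" for y
    by (simp add: matrix_vector_right_distrib)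
  obtain y where "\<And>i. (u + W *v y) $ i > 0"
      "\<And>j. (\<Sum>i\<in>UNIV. B $ i $ j * ln ((u + W *v y) $ i)) = 0"
    using dominating_log_system_solvable[OF assms(7) gale_dual_exponent_matrix_mixed[OF assms(6)]
        sgn_eq, of u] t(2) by (auto simp: u_def)
  then have "positive_solutions a C \<noteq> {}"
    by (intro positive_solution_from_log_system[OF assms(6) ker])
  then show ?thesis
    by (simp add: num_positive_solutions_def card_gt_0_iff zero_enat_def)
qed

end
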